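(* There exists a countable group $\Gamma$ for which $\mathrm{Zar}^{+}(\Gamma) \neq \mathrm{Zar}(\Gamma)$; that is, the semigroup Zariski topology on $\Gamma$ and the group Zariski topology on $\Gamma$ do not coincide.
   Context: Let $\Gamma$ be a group. Semigroup Zariski topology. Let $\langle \mathbf{x}\rangle^{+}=\{1,\mathbf{x},\mathbf{x}^2,\dots\}$ be the free monogenic monoid. Elements $W(\mathbf{x})$ of the free product $\Gamma * \langle \mathbf{x}\rangle^{+}$ ($\Gamma$ being regarded here as a semigroup) are expressions of the form $W(\mathbf{x}) = s_0\mathbf{x}^{i_1}s_1\cdots s_n\mathbf{x}^{i_n}s_{n+1}$ with integers $i_1,\dots,i_n\geq 0$ and coefficients $s_0,\dots,s_{n+1}\in\Gamma$. Each such $W(\mathbf{x})$ is interpreted as a function $W:\Gamma\to\Gamma$ by substituting $x\in\Gamma$ for $\mathbf{x}$. The semigroup Zariski topology $\mathrm{Zar}^{+}(\Gamma)$ is the topology on $\Gamma$ having as a subbase of open sets the sets $\mathcal{O}_{W,V}=\{x\in\Gamma \mid W(x)\neq V(x)\}$, where $W(\mathbf{x}),V(\mathbf{x})$ range over $\Gamma * \langle \mathbf{x}\rangle^{+}$. Group Zariski topology. Let $\langle \mathbf{x}\rangle$ be an infinite cyclic group generated by $\mathbf{x}$. Elements $W(\mathbf{x})$ of the free product of groups $\Gamma * \langle \mathbf{x}\rangle$ are expressions of the form $W(\mathbf{x}) = g_0\mathbf{x}^{i_1}g_1\cdots g_n\mathbf{x}^{i_n}g_{n+1}$ with arbitrary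 integers $i_1,\dots,i_n$ and coefficients $g_0,\dots,g_{n+1}\in\Gamma$, and are again interpreted as functions $W:\Gamma\to\Gamma$ by substitution. The group Zariski topology $\mathrm{Zar}(\Gamma)$ is the topology on $\Gamma$ having as a subbase of open sets the sets $\mathcal{O}_{W}=\{x\in\Gamma\mid W(x)\neq 1\}$, where $W(\mathbf{x})$ ranges over $\Gamma * \langle\mathbf{x}\rangle$. *)

theory Defs
  imports "HOL-Analysis.Abstract_Topology" "HOL-Library.Countable_Set" "HOL-Algebra.Group"
begin

text \<open>
  The expression \<open>s\<^sub>0 x\<^sup>i\<^sup>1 s\<^sub>1 \<dots> x\<^sup>i\<^sup>n s\<^sub>n\<close> is encoded as \<open>(s\<^sub>0, [(i\<^sub>1, s\<^sub>1), \<dots>, (i\<^sub>n, s\<^sub>n)])\<close>;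
  exponents may be zero and coefficients may be trivial. Several expressions can denote the
  same element of the free product; they then induce the same function by substitution, so
  families of sets indexed by elements of the free product may be indexed by expressions.
\<close>

type_synonym ('a, 'i) expr = "'a \<times> ('i \<times> 'a) list"

definition exprs :: "('a, 'b) monoid_scheme \<Rightarrow> ('a, 'i) expr set" where
  "exprs \<Gamma> = carrier \<Gamma> \<times> lists (UNIV \<times> carrier \<Gamma>)"

fun sgp_subst :: "('a, 'b) monoid_scheme \<Rightarrow> ('a, nat) expr \<Rightarrow> 'a \<Rightarrow> 'a" where
  "sgp_subst \<Gamma> (s, ps) x =
     foldl (\<lambda>y (i, t). y \<otimes>\<^bsub>\<Gamma>\<^esub> (x [^]\<^bsub>\<Gamma>\<^esub> i) \<otimes>\<^bsub>\<Gamma>\<^esub> t) s ps"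

fun grp_subst :: "('a, 'b) monoid_scheme \<Rightarrow> ('a, int) expr \<Rightarrow> 'a \<Rightarrow> 'a" where
  "grp_subst \<Gamma> (g, ps) x =
     foldl (\<lambda>y (i, t). y \<otimes>\<^bsub>\<Gamma>\<^esub> (x [^]\<^bsub>\<Gamma>\<^esub> i) \<otimes>\<^bsub>\<Gamma>\<^esub> t) g ps"

text \<open>
  The clause \<open>relative_to X\<close> makes the empty intersection equal to \<open>X\<close>, so that the
  space is \<open>X\<close> even if the subbase does not cover it (as happens for the trivial group).
\<close>

definition subbase_topology :: "'a set \<Rightarrow> 'a set set \<Rightarrow> 'a topology" where
  "subbase_topology X \<S> =
     topology (arbitrary union_of (finite intersection_of (\<lambda>S. S \<in> \<S>) relative_to X))"

definition sgp_zariski :: "('a, 'b) monoid_scheme \<Rightarrow> 'a topology" where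
  "sgp_zariski \<Gamma> = subbase_topology (carrier \<Gamma>)
     {{x \<in> carrier \<Gamma>. sgp_subst \<Gamma> W x \<noteq> sgp_subst \<Gamma> V x} | W V.
        W \<in> exprs \<Gamma> \<and> V \<in> exprs \<Gamma>}"

definition grp_zariski :: "('a, 'b) monoid_scheme \<Rightarrow> 'a topology" where
  "grp_zariski \<Gamma> = subbase_topology (carrier \<Gamma>)
     {{x \<in> carrier \<Gamma>. grp_subst \<Gamma> W x \<noteq> \<one>\<^bsub>\<Gamma>\<^esub>} | W. W \<in> exprs \<Gamma>}"

lemma openin_subbase_topology:
  "openin (subbase_topology X \<S>) U \<longleftrightarrow>
     (arbitrary union_of (finite intersection_of (\<lambda>S. S \<in> \<S>) relative_to X)) U"
  unfolding subbase_topology_def by (simp add: istopology_subbase)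

lemma topspace_subbase_topology: "topspace (subbase_topology X \<S>) = X"
  unfolding subbase_topology_def by (rule topspace_subbase)

lemma topspace_sgp_zariski: "topspace (sgp_zariski \<Gamma>) = carrier \<Gamma>"
  by (simp add: sgp_zariski_def topspace_subbase_topology)

lemma topspace_grp_zariski: "topspace (grp_zariski \<Gamma>) = carrier \<Gamma>"
  by (simp add: grp_zariski_def topspace_subbase_topology)

end

theory Submission
  imports Defs "HOL-Combinatorics.Permutations"
begin

text \<open>
  The group is the finitary symmetric group of the natural numbers: the permutations that move
  only finitely many points. Let \<open>a\<close> and \<open>b\<close> be two permutations in it that do not commute.
  The set \<open>A\<close> of all \<open>x\<close> such that \<open>x b x\<^sup>-\<^sup>1\<close> commutes with \<open>a\<close> is closed in the group Zariski
  topology and does not contain the identity. The identity is nevertheless in the closure of \<open>A\<close>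
  with respect to the semigroup Zariski topology, so the two topologies differ.

  To see this, collect adjacent coefficients: every positive expression then has a normal form
  \<open>g\<^sub>0 x g\<^sub>1 x \<dots> x g\<^sub>n\<close>, determined by its list of coefficients. A basic semigroup neighbourhood of
  the identity is given by finitely many inequations \<open>W(x) \<noteq> V(x)\<close> that hold at the identity; in
  particular the normal forms of \<open>W\<close> and \<open>V\<close> are different lists. It suffices to find one \<open>t \<in> A\<close>
  at which finitely many prescribed different normal forms all take different values
  (\<open>zariski_topologies_differ\<close>).

  Choose \<open>m\<close> such that all permutations involved fix every point \<open>\<ge> m\<close>, and let \<open>t\<close> be a finitary
  permutation that maps \<open>y\<close> to \<open>y + m\<close> on a long initial segment. Then \<open>t b t\<^sup>-\<^sup>1\<close> is supported
  outside \<open>{0..<m}\<close>, so it commutes with \<open>a\<close>. The word \<open>g\<^sub>0 t g\<^sub>1 t \<dots> t g\<^sub>n\<close> maps a point \<open>y < m\<close> to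
  \<open>g\<^sub>n(y) + n m\<close>, because after the first application of \<open>t\<close> no coefficient moves the point any
  more. The values for \<open>y < m\<close> thus determine both \<open>n\<close> and \<open>g\<^sub>n\<close>; cancelling \<open>t g\<^sub>n\<close> on the right and
  inducting recovers all coefficients (\<open>shift_words_inj\<close>).
\<close>

section \<open>Normal forms of positive expressions\<close>

text \<open>
  The value at \<open>x\<close> of a positive word in normal form. The coefficients are listed from right to
  left: \<open>[g\<^sub>n, \<dots>, g\<^sub>1, g\<^sub>0]\<close> stands for \<open>g\<^sub>0 x g\<^sub>1 x \<dots> x g\<^sub>n\<close>. Only nonempty lists are meaningful; the
  value at the empty list is a default.
\<close>

fun pos_word :: "('a, 'b) monoid_scheme \<Rightarrow> 'a \<Rightarrow> 'a list \<Rightarrow> 'a" where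
  "pos_word G x [] = \<one>\<^bsub>G\<^esub>"
| "pos_word G x [g] = g"
| "pos_word G x (g # h # gs) = pos_word G x (h # gs) \<otimes>\<^bsub>G\<^esub> x \<otimes>\<^bsub>G\<^esub> g"

text \<open>
  Multiplication on the right by \<open>x\<^sup>i t\<close>, in terms of coefficient lists: each factor \<open>x\<close> opens
  a new coefficient, initially trivial, and \<open>t\<close> is absorbed into the last one.
\<close>

definition append_power :: "('a, 'b) monoid_scheme \<Rightarrow> 'a list \<Rightarrow> nat \<times> 'a \<Rightarrow> 'a list" where
  "append_power G L p =
     (let L' = replicate (fst p) \<one>\<^bsub>G\<^esub> @ L in (hd L' \<otimes>\<^bsub>G\<^esub> snd p) # tl L')"

text \<open>The coefficient list of the normal form of an expression.\<close>

definition coeffs :: "('a, 'b) monoid_scheme \<Rightarrow> ('a, nat) expr \<Rightarrow> 'a list" where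
  "coeffs G W = foldl (append_power G) [fst W] (snd W)"

context group
begin

lemma pos_word_closed:
  assumes "x \<in> carrier G" "set L \<subseteq> carrier G"
  shows "pos_word G x L \<in> carrier G"
  using assms by (induction L rule: induct_list012) auto

lemma pos_word_replicate_one:
  assumes "x \<in> carrier G" "set L \<subseteq> carrier G" "L \<noteq> []"
  shows "pos_word G x (replicate i \<one> @ L) = pos_word G x L \<otimes> x [^] i"
proof (induction i)
  case 0
  then show ?case using assms pos_word_closed by simp
next
  case (Suc i)
  obtain h hs where h: "replicate i \<one> @ L = h # hs"
    using assms(3) by (cases "replicate i \<one> @ L") auto
  have "pos_word G x (replicate (Suc i) \<one> @ L) = pos_word G x (\<one> # h # hs)"
    using h by simp
  also have "\<dots> = pos_word G x (h # hs) \<otimes> x \<otimes> \<one>"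
    by simp
  also have "\<dots> = pos_word G x L \<otimes> x [^] i \<otimes> x \<otimes> \<one>"
    using Suc h by simp
  also have "\<dots> = pos_word G x L \<otimes> x [^] Suc i"
    using assms pos_word_closed[OF assms(1,2)] by (simp add: m_assoc)
  finally show ?case .
qed

lemma pos_word_mult_hd:
  assumes "x \<in> carrier G" "set L \<subseteq> carrier G" "L \<noteq> []" "t \<in> carrier G"
  shows "pos_word G x ((hd L \<otimes> t) # tl L) = pos_word G x L \<otimes> t"
proof -
  obtain g gs where L: "L = g # gs"
    using assms(3) by (cases L) auto
  show ?thesis
  proof (cases gs)
    case Nil
    then show ?thesis using L by simp
  next
    case (Cons h hs)
    then show ?thesis
      using L assms pos_word_closed[OF assms(1), of gs] by (simp add: m_assoc)
  qed
qed

lemma append_power: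
  assumes "set L \<subseteq> carrier G" "L \<noteq> []" "t \<in> carrier G"
  shows "set (append_power G L (i, t)) \<subseteq> carrier G"
    and "append_power G L (i, t) \<noteq> []"
    and "x \<in> carrier G \<Longrightarrow>
      pos_word G x (append_power G L (i, t)) = pos_word G x L \<otimes> x [^] i \<otimes> t"
proof -
  define L' where "L' = replicate i \<one> @ L"
  have L': "set L' \<subseteq> carrier G" "L' \<noteq> []"
    using assms by (auto simp: L'_def)
  have eq: "append_power G L (i, t) = (hd L' \<otimes> t) # tl L'"
    by (simp add: append_power_def L'_def Let_def)
  show "set (append_power G L (i, t)) \<subseteq> carrier G"
    using L' assms(3) unfolding eq by (cases L') auto
  show "append_power G L (i, t) \<noteq> []"
    unfolding eq by simp
  show "pos_word G x (append_power G L (i, t)) = pos_word G x L \<otimes> x [^] i \<otimes> t"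
    if "x \<in> carrier G"
    using pos_word_mult_hd[OF that L' assms(3)] pos_word_replicate_one[OF that assms(1,2)]
    unfolding eq by (simp add: L'_def)
qed

lemma foldl_append_power:
  assumes "set L \<subseteq> carrier G" "L \<noteq> []" "ps \<in> lists (UNIV \<times> carrier G)"
  shows "set (foldl (append_power G) L ps) \<subseteq> carrier G"
    and "foldl (append_power G) L ps \<noteq> []"
    and "x \<in> carrier G \<Longrightarrow> pos_word G x (foldl (append_power G) L ps) =
      foldl (\<lambda>y (i, t). y \<otimes> (x [^] i) \<otimes> t) (pos_word G x L) ps"
  using assms
proof (induction ps arbitrary: L)
  case (Cons p ps)
  obtain i t where p: "p = (i, t)" by (cases p)
  { case 1
    then show ?case using Cons.IH(1)[of "append_power G L p"] append_power p by auto
  next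
    case 2
    then show ?case using Cons.IH(2)[of "append_power G L p"] append_power p by auto
  next
    case 3
    then show ?case using Cons.IH(3)[of "append_power G L p"] append_power p by auto
  }
qed auto

lemma coeffs:
  assumes "W \<in> exprs G"
  shows "coeffs G W \<in> lists (carrier G) - {[]}"
    and "x \<in> carrier G \<Longrightarrow> sgp_subst G W x = pos_word G x (coeffs G W)"
proof -
  obtain s ps where W: "W = (s, ps)" by (cases W)
  have s: "set [s] \<subseteq> carrier G" "[s] \<noteq> []" "ps \<in> lists (UNIV \<times> carrier G)"
    using assms by (auto simp: exprs_def W)
  show "coeffs G W \<in> lists (carrier G) - {[]}"
    using foldl_append_power(1,2)[OF s] by (auto simp: coeffs_def W in_lists_conv_set)
  show "x \<in> carrier G \<Longrightarrow> sgp_subst G W x = pos_word G x (coeffs G W)"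
    using foldl_append_power(3)[OF s] by (simp add: coeffs_def W)
qed

section \<open>A criterion for the two topologies to differ\<close>

text \<open>
  The hypothesis \<open>generic\<close> says that some \<open>t\<close> with \<open>t b t\<^sup>-\<^sup>1\<close> commuting with \<open>a\<close> separates any
  given finite set of positive words. It puts the identity in the closure, with respect to the
  semigroup Zariski topology, of the set of all such \<open>t\<close>; as \<open>a\<close> and \<open>b\<close> do not commute, the
  identity is outside this set, which is closed in the group Zariski topology.
\<close>

lemma zariski_topologies_differ:
  assumes a: "a \<in> carrier G" and b: "b \<in> carrier G" and ab: "b \<otimes> a \<noteq> a \<otimes> b"
    and generic: "\<And>\<L>. \<L> \<subseteq> lists (carrier G) - {[]} \<Longrightarrow> finite \<L> \<Longrightarrow>
      \<exists>t \<in> carrier G. t \<otimes> b \<otimes> inv t \<otimes> a = a \<otimes> (t \<otimes> b \<otimes> inv t) \<and> inj_on (pos_word G t) \<L>"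
  shows "sgp_zariski G \<noteq> grp_zariski G"
proof
  assume eq: "sgp_zariski G = grp_zariski G"
  \<comment> \<open>the commutator of \<open>x b x\<^sup>-\<^sup>1\<close> and \<open>a\<close>\<close>
  define w :: "('a, int) expr" where "w = (\<one>, [(1, b), (-1, a), (1, inv b), (-1, inv a)])"
  have w_exprs: "w \<in> exprs G"
    using a b by (auto simp: w_def exprs_def)
  have w_eq_one_iff: "grp_subst G w x = \<one> \<longleftrightarrow> x \<otimes> b \<otimes> inv x \<otimes> a = a \<otimes> (x \<otimes> b \<otimes> inv x)"
    if x: "x \<in> carrier G" for x
  proof -
    define c where "c = x \<otimes> b \<otimes> inv x"
    have c: "c \<in> carrier G" using x b by (simp add: c_def)
    have inv_c: "inv c = x \<otimes> inv b \<otimes> inv x"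
      using x b by (simp add: c_def inv_mult_group m_assoc)
    have "grp_subst G w x = c \<otimes> a \<otimes> inv c \<otimes> inv a"
      unfolding inv_c unfolding c_def
      using x a b by (simp add: w_def int_pow_neg int_pow_1 m_assoc)
    also have "\<dots> = (c \<otimes> a) \<otimes> inv (a \<otimes> c)"
      using a c by (simp add: inv_mult_group m_assoc)
    finally have "grp_subst G w x = (c \<otimes> a) \<otimes> inv (a \<otimes> c)" .
    moreover have "(c \<otimes> a) \<otimes> inv (a \<otimes> c) = \<one> \<longleftrightarrow> c \<otimes> a = a \<otimes> c"
      using a c inv_equality[of "c \<otimes> a" "inv (a \<otimes> c)"] by auto
    ultimately show ?thesis
      unfolding c_def by simp
  qed
  define U where "U = {x \<in> carrier G. grp_subst G w x \<noteq> \<one>}"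
  have "openin (grp_zariski G) U"
    unfolding grp_zariski_def openin_subbase_topology
  proof (rule arbitrary_union_of_inc)
    let ?Q = "finite intersection_of
      (\<lambda>S. S \<in> {{x \<in> carrier G. grp_subst G W x \<noteq> \<one>} | W. W \<in> exprs G})"
    have "?Q U"
      by (rule finite_intersection_of_inc) (use w_exprs in \<open>auto simp only: U_def mem_Collect_eq\<close>)
    moreover have "carrier G \<inter> U = U"
      by (auto simp: U_def)
    ultimately show "(?Q relative_to carrier G) U"
      unfolding relative_to_def by blast
  qed
  then have "openin (sgp_zariski G) U"
    using eq by simp
  moreover have "\<one> \<in> U"
    using w_eq_one_iff[of \<one>] a b ab by (simp add: U_def)
  moreover define \<S> where
    "\<S> = {{x \<in> carrier G. sgp_subst G W x \<noteq> sgp_subst G V x} | W V. W \<in> exprs G \<and> V \<in> exprs G}"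
  ultimately obtain B where
      B: "(finite intersection_of (\<lambda>S. S \<in> \<S>) relative_to carrier G) B" "\<one> \<in> B" "B \<subseteq> U"
    unfolding sgp_zariski_def openin_subbase_topology arbitrary_union_of_alt by blast
  then obtain \<F> where "finite \<F>" "\<F> \<subseteq> \<S>" "B = carrier G \<inter> \<Inter>\<F>"
    unfolding relative_to_def intersection_of_def by blast
  then have \<F>: "finite \<F>" "\<F> \<subseteq> \<S>" "\<one> \<in> carrier G \<inter> \<Inter>\<F>" "carrier G \<inter> \<Inter>\<F> \<subseteq> U"
    using B(2,3) by simp_all
  have "\<forall>S \<in> \<F>. \<exists>W V. W \<in> exprs G \<and> V \<in> exprs G \<and>
      S = {x \<in> carrier G. sgp_subst G W x \<noteq> sgp_subst G V x}"
    using \<F>(2) unfolding \<S>_def by blast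
  then obtain W V where "\<forall>S \<in> \<F>. W S \<in> exprs G \<and> V S \<in> exprs G \<and>
      S = {x \<in> carrier G. sgp_subst G (W S) x \<noteq> sgp_subst G (V S) x}"
    unfolding bchoice_iff by (elim exE)
  then have WV: "\<And>S. S \<in> \<F> \<Longrightarrow> W S \<in> exprs G" "\<And>S. S \<in> \<F> \<Longrightarrow> V S \<in> exprs G"
      "\<And>S. S \<in> \<F> \<Longrightarrow> S = {x \<in> carrier G. sgp_subst G (W S) x \<noteq> sgp_subst G (V S) x}"
    by blast+
  define \<L> where "\<L> = (\<lambda>S. coeffs G (W S)) ` \<F> \<union> (\<lambda>S. coeffs G (V S)) ` \<F>"
  have "\<L> \<subseteq> lists (carrier G) - {[]}"
    unfolding \<L>_def by (intro Un_least image_subsetI coeffs(1) WV(1,2))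
  moreover have "finite \<L>"
    unfolding \<L>_def using \<F>(1) by simp
  ultimately obtain t where t: "t \<in> carrier G"
      "t \<otimes> b \<otimes> inv t \<otimes> a = a \<otimes> (t \<otimes> b \<otimes> inv t)" "inj_on (pos_word G t) \<L>"
    using generic by blast
  have "t \<in> S" if S: "S \<in> \<F>" for S
  proof -
    have "\<one> \<in> S"
      using \<F>(3) S by blast
    then have "sgp_subst G (W S) \<one> \<noteq> sgp_subst G (V S) \<one>"
      using WV(3)[OF S] by blast
    then have "coeffs G (W S) \<noteq> coeffs G (V S)"
      using coeffs(2)[OF WV(1)[OF S], of \<one>] coeffs(2)[OF WV(2)[OF S], of \<one>] by auto
    then have "pos_word G t (coeffs G (W S)) \<noteq> pos_word G t (coeffs G (V S))"
      using inj_onD[OF t(3)] S unfolding \<L>_def by blast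
    then have "sgp_subst G (W S) t \<noteq> sgp_subst G (V S) t"
      using coeffs(2)[OF WV(1)[OF S] t(1)] coeffs(2)[OF WV(2)[OF S] t(1)] by simp
    then show ?thesis
      using WV(3)[OF S] t(1) by blast
  qed
  then have "t \<in> U"
    using \<F>(4) t(1) by blast
  then show False
    using t(2) w_eq_one_iff[OF t(1)] by (simp add: U_def)
qed

end

section \<open>Generic shifts\<close>

lemma ex_block_shift:
  fixes m N :: nat
  shows "\<exists>t. permutation t \<and> (\<forall>x < m * N. t x = x + m)"
proof (intro exI conjI)
  \<comment> \<open>the cyclic rotation by one of \<open>N + 1\<close> consecutive blocks of length \<open>m\<close>\<close>
  define t where "t = (\<lambda>x. if x < m * N then x + m else if x < m * N + m then x - m * N else x)"
  define s where "s = (\<lambda>x. if x < m then x + m * N else if x < m * N + m then x - m else x)"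
  have "s \<circ> t = id" "t \<circ> s = id"
    by (auto simp: fun_eq_iff s_def t_def)
  then have "bij t"
    by (rule o_bij)
  moreover have "{x. t x \<noteq> x} \<subseteq> {..<m * N + m}"
    by (auto simp: t_def split: if_splits)
  then have "finite {x. t x \<noteq> x}"
    using finite_subset by blast
  ultimately show "permutation t"
    by (simp add: permutation)
  show "\<forall>x < m * N. t x = x + m"
    by (simp add: t_def)
qed

text \<open>
  The words are evaluated in a group \<open>G\<close> that acts on the natural numbers through \<open>d\<close>. After the
  coefficient \<open>g\<close>, which acts first, a sufficiently small point is moved by the factors \<open>t\<close> only.
\<close>

lemma (in group) shift_word_apply:
  fixes d :: "'a \<Rightarrow> nat \<Rightarrow> nat"
  assumes hom: "\<And>x y. x \<in> carrier G \<Longrightarrow> y \<in> carrier G \<Longrightarrow> d (x \<otimes> y) = d x \<circ> d y"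
    and t: "t \<in> carrier G" "\<And>x. x < m * N \<Longrightarrow> d t x = x + m"
  assumes "g \<in> carrier G" "set gs \<subseteq> carrier G"
    and "\<And>h x. h \<in> set gs \<Longrightarrow> m \<le> x \<Longrightarrow> d h x = x"
    and "d g y + length gs * m < m * N + m"
  shows "d (pos_word G t (g # gs)) y = d g y + length gs * m"
  using assms(4-)
proof (induction gs arbitrary: g y)
  case Nil
  then show ?case by simp
next
  case (Cons h hs)
  have P: "pos_word G t (h # hs) \<in> carrier G"
    using Cons.prems t(1) by (intro pos_word_closed) auto
  have h: "d h (d g y + m) = d g y + m"
    using Cons.prems(3) by simp
  have "d (pos_word G t (g # h # hs)) y = d (pos_word G t (h # hs)) (d t (d g y))"
    using P Cons.prems(1) t(1) hom by simp
  also have "d t (d g y) = d g y + m"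
    using Cons.prems(4) by (intro t(2)) simp
  also have "d (pos_word G t (h # hs)) (d g y + m) = d h (d g y + m) + length hs * m"
    by (rule Cons.IH) (use Cons.prems h in auto)
  finally show ?case
    using h by simp
qed

lemma (in group) shift_words_inj:
  fixes d :: "'a \<Rightarrow> nat \<Rightarrow> nat"
  assumes hom: "\<And>x y. x \<in> carrier G \<Longrightarrow> y \<in> carrier G \<Longrightarrow> d (x \<otimes> y) = d x \<circ> d y"
    and inj: "inj_on d (carrier G)" "\<And>x. x \<in> carrier G \<Longrightarrow> inj (d x)"
    and t: "t \<in> carrier G" "\<And>x. x < m * N \<Longrightarrow> d t x = x + m"
    and S: "S \<subseteq> carrier G" "\<And>h x. h \<in> S \<Longrightarrow> m \<le> x \<Longrightarrow> d h x = x"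
    and m: "0 < m"
  shows "inj_on (pos_word G t) {L \<in> lists S. L \<noteq> [] \<and> length L \<le> Suc N}"
proof -
  have below: "d g y < m" if "g \<in> S" "y < m" for g y
  proof (rule ccontr)
    assume "\<not> d g y < m"
    then have "d g (d g y) = d g y"
      using S(2) that(1) by simp
    then have "d g y = y"
      using inj(2)[of g] S(1) that(1) by (auto dest: injD)
    then show False
      using \<open>\<not> d g y < m\<close> that(2) by simp
  qed
  have apply_word: "d (pos_word G t (g # gs)) y = d g y + length gs * m"
    if "set (g # gs) \<subseteq> S" "length gs \<le> N" "y < m" for g gs y
  proof (rule shift_word_apply[OF hom t])
    have "length gs * m \<le> m * N"
      using that(2) by simp
    moreover have "d g y < m"
      using below that(1,3) by simp
    ultimately show "d g y + length gs * m < m * N + m"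
      by linarith
  qed (use that S in auto)
  \<comment> \<open>quotient and remainder modulo \<open>m\<close> separate the number of factors \<open>t\<close> from the first action\<close>
  have first: "g = h \<and> length gs = length hs"
    if "set (g # gs) \<subseteq> S" "set (h # hs) \<subseteq> S" "length gs \<le> N" "length hs \<le> N"
      "pos_word G t (g # gs) = pos_word G t (h # hs)" for g gs h hs
  proof -
    have eq: "d g y + length gs * m = d h y + length hs * m" if "y < m" for y
      using apply_word[of g gs y] apply_word[of h hs y] \<open>set (g # gs) \<subseteq> S\<close> \<open>set (h # hs) \<subseteq> S\<close>
        \<open>length gs \<le> N\<close> \<open>length hs \<le> N\<close> \<open>pos_word G t (g # gs) = pos_word G t (h # hs)\<close> that
      by simp
    have "(d g 0 + length gs * m) div m = length gs" "(d h 0 + length hs * m) div m = length hs"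
      using below[of g 0] below[of h 0] m that(1,2) by simp_all
    then have len: "length gs = length hs"
      using eq[OF m] by simp
    have "d g y = d h y" for y
      using eq[of y] len S(2)[of g y] S(2)[of h y] that(1,2) by (cases "y < m") auto
    then have "d g = d h" by auto
    then have "g = h"
      using inj(1) S(1) that(1,2) by (auto dest: inj_onD)
    then show ?thesis using len by simp
  qed
  have *: "g # gs = h # hs"
    if "set (g # gs) \<subseteq> S" "set (h # hs) \<subseteq> S" "length gs \<le> N" "length hs \<le> N"
      "pos_word G t (g # gs) = pos_word G t (h # hs)" for g gs h hs
    using that
  proof (induction gs arbitrary: g h hs)
    case Nil
    then show ?case using first[of g "[]" h hs] by simp
  next
    case (Cons k ks)
    then have gh: "g = h" and "length hs = Suc (length ks)"
      using first[of g "k # ks" h hs] by auto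
    then obtain l ls where hs: "hs = l # ls"
      by (cases hs) auto
    have "set (k # ks) \<subseteq> carrier G" "set (l # ls) \<subseteq> carrier G" "g \<in> carrier G"
      using Cons.prems(1,2) S(1) unfolding hs by auto
    then have mem: "pos_word G t (k # ks) \<in> carrier G" "pos_word G t (l # ls) \<in> carrier G"
        "g \<in> carrier G"
      using pos_word_closed[OF t(1)] by blast+
    have "pos_word G t (k # ks) \<otimes> t \<otimes> g = pos_word G t (l # ls) \<otimes> t \<otimes> g"
      using Cons.prems(5) gh hs by simp
    then have "pos_word G t (k # ks) = pos_word G t (l # ls)"
      using mem t(1) by simp
    then have "k # ks = l # ls"
      using Cons.prems hs by (intro Cons.IH) auto
    then show ?case using gh hs by simp
  qed
  show ?thesis
  proof (rule inj_onI)
    fix L L'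
    assume L: "L \<in> {L \<in> lists S. L \<noteq> [] \<and> length L \<le> Suc N}"
      "L' \<in> {L \<in> lists S. L \<noteq> [] \<and> length L \<le> Suc N}" "pos_word G t L = pos_word G t L'"
    obtain g gs h hs where eqs: "L = g # gs" "L' = h # hs"
      using L(1,2) by (cases L; cases L') auto
    show "L = L'"
      unfolding eqs by (rule *) (use L eqs in auto)
  qed
qed

section \<open>The finitary symmetric group\<close>

lemma permutation_fixes_ge:
  fixes p :: "nat \<Rightarrow> nat"
  assumes "permutation p"
  shows "\<exists>m. \<forall>x \<ge> m. p x = x"
proof -
  have "finite {x. p x \<noteq> x}"
    using assms by (simp add: permutation)
  then obtain m where "\<forall>x \<in> {x. p x \<noteq> x}. x < m"
    using finite_nat_set_iff_bounded by blast
  then show ?thesis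
    by (metis (mono_tags) mem_Collect_eq not_le)
qed

lemma countable_permutations: "countable {p :: nat \<Rightarrow> nat. permutation p}"
proof -
  define graph :: "(nat \<Rightarrow> nat) \<Rightarrow> (nat \<times> nat) set" where "graph p = (\<lambda>x. (x, p x)) ` {x. p x \<noteq> x}" for p
  have "inj graph"
  proof (rule injI, rule ext)
    fix p q x
    assume "graph p = graph q"
    then have "(x, y) \<in> graph p \<longleftrightarrow> (x, y) \<in> graph q" for y
      by simp
    then have "y = p x \<and> p x \<noteq> x \<longleftrightarrow> y = q x \<and> q x \<noteq> x" for y
      by (auto simp: graph_def image_iff)
    then show "p x = q x"
      by metis
  qed
  moreover have "graph ` {p. permutation p} \<subseteq> {A. finite A}"
    by (auto simp: graph_def permutation)
  then have "countable (graph ` {p. permutation p})"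
    using countable_Collect_finite countable_subset by blast
  ultimately show ?thesis
    using countable_image_inj_on inj_on_subset subset_UNIV by blast
qed

text \<open>
  An enumeration of the finitary permutations and its inverse. The value of \<open>nat_of_fsym\<close> matters
  at finitary permutations only.
\<close>

definition fsym_of_nat :: "nat \<Rightarrow> nat \<Rightarrow> nat" where
  "fsym_of_nat = from_nat_into {p. permutation p}"

definition nat_of_fsym :: "(nat \<Rightarrow> nat) \<Rightarrow> nat" where
  "nat_of_fsym = to_nat_on {p. permutation p}"

text \<open>
  The finitary symmetric group, with its elements renamed to natural numbers along this enumeration.
\<close>

definition FSym :: "nat monoid" where
  "FSym = \<lparr>carrier = nat_of_fsym ` {p. permutation p},
           monoid.mult = (\<lambda>x y. nat_of_fsym (fsym_of_nat x \<circ> fsym_of_nat y)),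
           monoid.one = nat_of_fsym id\<rparr>"

lemma fsym_of_nat_of_fsym: "permutation p \<Longrightarrow> fsym_of_nat (nat_of_fsym p) = p"
  unfolding fsym_of_nat_def nat_of_fsym_def
  by (rule from_nat_into_to_nat_on[OF countable_permutations]) simp

lemma carrier_FSym: "carrier FSym = nat_of_fsym ` {p. permutation p}"
  by (simp add: FSym_def)

lemma one_FSym: "\<one>\<^bsub>FSym\<^esub> = nat_of_fsym id"
  by (simp add: FSym_def)

lemma mult_FSym: "x \<otimes>\<^bsub>FSym\<^esub> y = nat_of_fsym (fsym_of_nat x \<circ> fsym_of_nat y)"
  by (simp add: FSym_def)

lemma permutation_fsym_of_nat: "x \<in> carrier FSym \<Longrightarrow> permutation (fsym_of_nat x)"
  by (auto simp: carrier_FSym fsym_of_nat_of_fsym)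

lemma inj_on_fsym_of_nat: "inj_on fsym_of_nat (carrier FSym)"
  by (auto simp: carrier_FSym inj_on_def fsym_of_nat_of_fsym)

lemma fsym_of_nat_mult:
  assumes "x \<in> carrier FSym" "y \<in> carrier FSym"
  shows "fsym_of_nat (x \<otimes>\<^bsub>FSym\<^esub> y) = fsym_of_nat x \<circ> fsym_of_nat y"
  using assms
  by (simp add: mult_FSym fsym_of_nat_of_fsym permutation_compose permutation_fsym_of_nat)

lemma group_FSym: "group FSym"
proof (rule groupI)
  fix x y z
  assume xyz: "x \<in> carrier FSym" "y \<in> carrier FSym" "z \<in> carrier FSym"
  then show "x \<otimes>\<^bsub>FSym\<^esub> y \<otimes>\<^bsub>FSym\<^esub> z = x \<otimes>\<^bsub>FSym\<^esub> (y \<otimes>\<^bsub>FSym\<^esub> z)"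
    by (auto simp: carrier_FSym mult_FSym fsym_of_nat_of_fsym permutation_compose comp_assoc)
next
  fix x
  assume "x \<in> carrier FSym"
  then obtain p where p: "permutation p" "x = nat_of_fsym p"
    by (auto simp: carrier_FSym)
  then have "nat_of_fsym (inv_into UNIV p) \<otimes>\<^bsub>FSym\<^esub> x = \<one>\<^bsub>FSym\<^esub>"
    by (simp add: mult_FSym one_FSym fsym_of_nat_of_fsym permutation_inverse
        permutation_inverse_works(1))
  then show "\<exists>y \<in> carrier FSym. y \<otimes>\<^bsub>FSym\<^esub> x = \<one>\<^bsub>FSym\<^esub>"
    using p(1) permutation_inverse by (auto simp: carrier_FSym)
qed (auto simp: carrier_FSym mult_FSym one_FSym fsym_of_nat_of_fsym permutation_compose
    permutation_id)

text \<open>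
  The required \<open>t\<close> is a block shift: the block length \<open>m\<close> exceeds all points moved by \<open>a\<close>, \<open>b\<close> and
  the given coefficients, and the number of shifted blocks is at least the number of factors \<open>t\<close>
  in each of the given words.
\<close>

lemma FSym_generic_shift:
  assumes a: "a \<in> carrier FSym" and b: "b \<in> carrier FSym"
    and \<L>: "\<L> \<subseteq> lists (carrier FSym) - {[]}" "finite \<L>"
  shows "\<exists>t \<in> carrier FSym.
    t \<otimes>\<^bsub>FSym\<^esub> b \<otimes>\<^bsub>FSym\<^esub> inv\<^bsub>FSym\<^esub> t \<otimes>\<^bsub>FSym\<^esub> a = a \<otimes>\<^bsub>FSym\<^esub> (t \<otimes>\<^bsub>FSym\<^esub> b \<otimes>\<^bsub>FSym\<^esub> inv\<^bsub>FSym\<^esub> t) \<and>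
    inj_on (pos_word FSym t) \<L>"
proof -
  interpret group FSym by (rule group_FSym)
  let ?d = fsym_of_nat
  define S where "S = {a, b} \<union> (\<Union>L \<in> \<L>. set L)"
  have S: "S \<subseteq> carrier FSym" "finite S"
    using a b \<L> by (auto simp: S_def)
  have "\<exists>m. \<forall>x \<ge> m. ?d s x = x" if "s \<in> S" for s
    using permutation_fixes_ge permutation_fsym_of_nat S(1) that by blast
  then obtain M where M: "\<And>s x. s \<in> S \<Longrightarrow> M s \<le> x \<Longrightarrow> ?d s x = x"
    by metis
  define m where "m = Suc (Max (M ` S))"
  have fix_ge: "?d s x = x" if "s \<in> S" "m \<le> x" for s x
  proof (rule M[OF that(1)])
    have "M s \<le> Max (M ` S)"
      using S(2) that(1) by simp
    then show "M s \<le> x"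
      using that(2) by (simp add: m_def)
  qed
  \<comment> \<open>the summand 1 is for the commutation with \<open>a\<close>: at least one block has to be shifted\<close>
  define N where "N = Suc (Max (length ` \<L>))"
  have len: "length L \<le> Suc N" if "L \<in> \<L>" for L
    using Max_ge[of "length ` \<L>" "length L"] \<L>(2) that unfolding N_def by (simp add: le_SucI)
  obtain \<tau> where \<tau>: "permutation \<tau>" "\<And>x. x < m * N \<Longrightarrow> \<tau> x = x + m"
    using ex_block_shift by blast
  define t where "t = nat_of_fsym \<tau>"
  have t: "t \<in> carrier FSym" "?d t = \<tau>"
    using \<tau>(1) by (auto simp: t_def carrier_FSym fsym_of_nat_of_fsym)
  have inj: "inj (?d x)" if "x \<in> carrier FSym" for x
    using permutation_fsym_of_nat[OF that] by (simp add: permutation bij_def)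
  have "inj_on (pos_word FSym t) {L \<in> lists S. L \<noteq> [] \<and> length L \<le> Suc N}"
    by (rule shift_words_inj[where d = ?d and m = m])
      (use fsym_of_nat_mult inj_on_fsym_of_nat inj t \<tau>(2) S(1) fix_ge in \<open>auto simp: m_def\<close>)
  moreover have "\<L> \<subseteq> {L \<in> lists S. L \<noteq> [] \<and> length L \<le> Suc N}"
    using \<L>(1) len by (auto simp: S_def)
  ultimately have "inj_on (pos_word FSym t) \<L>"
    by (rule inj_on_subset)
  moreover
  define c where "c = t \<otimes>\<^bsub>FSym\<^esub> b \<otimes>\<^bsub>FSym\<^esub> inv\<^bsub>FSym\<^esub> t"
  have c: "c \<in> carrier FSym"
    using t(1) b by (simp add: c_def)
  have "c \<otimes>\<^bsub>FSym\<^esub> t = t \<otimes>\<^bsub>FSym\<^esub> b"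
    using t(1) b by (simp add: c_def m_assoc)
  \<comment> \<open>\<open>c\<close> moves only images under \<open>\<tau>\<close> of points below \<open>m\<close>, and these lie in the next block\<close>
  then have c_t: "?d c (\<tau> y) = \<tau> (?d b y)" for y
    using fsym_of_nat_mult[OF c t(1)] fsym_of_nat_mult[OF t(1) b] t(2) by (metis comp_apply)
  have c_fix: "?d c x = x" if "x < m" for x
  proof -
    obtain y where y: "x = \<tau> y"
      using \<tau>(1) by (metis permutation bij_pointE)
    have "m \<le> y"
      using \<tau>(2)[of y] y that by (cases "y < m") (auto simp: N_def)
    then show ?thesis
      using c_t[of y] fix_ge[of b y] y by (simp add: S_def)
  qed
  have a_below: "?d a x < m" if "x < m" for x
    using fix_ge[of a "?d a x"] injD[OF inj[OF a], of "?d a x" x] that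
    by (fastforce simp: S_def not_le)
  have c_above: "m \<le> ?d c x" if "m \<le> x" for x
    using c_fix[of "?d c x"] injD[OF inj[OF c], of "?d c x" x] that
    by (fastforce simp: not_le)
  have "?d c (?d a x) = ?d a (?d c x)" for x
    using c_fix a_below c_above fix_ge[of a] by (cases "x < m") (auto simp: S_def)
  then have "?d (c \<otimes>\<^bsub>FSym\<^esub> a) = ?d (a \<otimes>\<^bsub>FSym\<^esub> c)"
    using a c by (simp add: fsym_of_nat_mult fun_eq_iff)
  then have "c \<otimes>\<^bsub>FSym\<^esub> a = a \<otimes>\<^bsub>FSym\<^esub> c"
    using inj_onD[OF inj_on_fsym_of_nat] a c by blast
  ultimately show ?thesis
    using t(1) unfolding c_def by blast
qed

theorem theorem1p2:
  shows "\<exists>\<Gamma> :: nat monoid. group \<Gamma> \<and> countable (carrier \<Gamma>) \<and> sgp_zariski \<Gamma> \<noteq> grp_zariski \<Gamma>"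
proof -
  define p q :: "nat \<Rightarrow> nat" where "p = transpose 0 1" and "q = transpose 1 2"
  have pq: "permutation p" "permutation q"
    by (simp_all add: p_def q_def permutation_swap_id)
  define a b where "a = nat_of_fsym p" and "b = nat_of_fsym q"
  have ab: "a \<in> carrier FSym" "b \<in> carrier FSym" "fsym_of_nat a = p" "fsym_of_nat b = q"
    using pq by (auto simp: a_def b_def carrier_FSym fsym_of_nat_of_fsym)
  have "(q \<circ> p) 0 \<noteq> (p \<circ> q) 0"
    by (simp add: p_def q_def transpose_def)
  then have "b \<otimes>\<^bsub>FSym\<^esub> a \<noteq> a \<otimes>\<^bsub>FSym\<^esub> b"
    using fsym_of_nat_mult ab by metis
  then have "sgp_zariski FSym \<noteq> grp_zariski FSym"
    using ab(1,2) FSym_generic_shift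
    by (intro group.zariski_topologies_differ[OF group_FSym, of a b]) simp_all
  then show ?thesis
    using group_FSym by (intro exI[of _ FSym]) simp
qed

end
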